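(* Let $x_1\geq x_2\geq x_3\geq x_4\geq x_5$ be real numbers such that $x_1+x_4\geq x_2+x_3$. Let $a_1,\dots,a_5\in\mathbb{R}$ satisfy $a_1\geq\max(|a_2|,|a_4|-a_5)$, $a_3\geq 0$, $a_5\geq 0$, and $a_3+a_5\geq |a_4|$, and let $g:\mathbb{R}\to\mathbb{R}$ be a function in class $\mathcal{G}$. Then $$\sum_{i=1}^5 a_i\prod_{\substack{1\leq j\leq 5\\ j\neq i}} g(x_i-x_j)\geq 0.$$
   Context: A function $g:\mathbb{R}\to\mathbb{R}$ is in class $\mathcal{G}$ if $g$ is either even or odd, $g(0)\geq 0$, and $g$ is monotonically nondecreasing on $[0,\infty)$. *)

theory Defs
  imports Complex_Main
begin

definition even_fun :: "(real \<Rightarrow> real) \<Rightarrow> bool" where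
  "even_fun g \<longleftrightarrow> (\<forall>t. g (- t) = g t)"

definition odd_fun :: "(real \<Rightarrow> real) \<Rightarrow> bool" where
  "odd_fun g \<longleftrightarrow> (\<forall>t. g (- t) = - g t)"

definition class_G :: "(real \<Rightarrow> real) set" where
  "class_G = {g. (even_fun g \<or> odd_fun g) \<and> g 0 \<ge> 0 \<and> mono_on {0..} g}"

end

theory Submission
  imports Defs
begin

text \<open>
  Write \<open>P\<^sub>i\<close> for the product of the \<open>g \<bar>x\<^sub>i - x\<^sub>j\<bar>\<close> over \<open>j \<noteq> i\<close>. Parity turns the sum into
  \<open>a\<^sub>1 P\<^sub>1 + s a\<^sub>2 P\<^sub>2 + a\<^sub>3 P\<^sub>3 + s a\<^sub>4 P\<^sub>4 + a\<^sub>5 P\<^sub>5\<close> with \<open>s = 1\<close> or \<open>s = -1\<close>. Monotonicity gives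
  \<open>P\<^sub>1 \<ge> P\<^sub>2\<close> and \<open>P\<^sub>5 \<ge> P\<^sub>4\<close>, and with the extra spacing hypothesis also
  \<open>P\<^sub>1 + P\<^sub>3 \<ge> P\<^sub>2 + P\<^sub>4\<close>. With \<open>c = max 0 (\<bar>a\<^sub>4\<bar> - a\<^sub>5)\<close>, the sum is at least
  \<open>c (P\<^sub>1 - P\<^sub>2 + P\<^sub>3 - P\<^sub>4) + (\<bar>a\<^sub>4\<bar> - c) (P\<^sub>5 - P\<^sub>4)\<close>.
\<close>

lemma class_G_parity:
  assumes "g \<in> class_G"
  obtains s :: real where "s = 1 \<or> s = -1" "\<And>t. g (- t) = s * g t"
proof (cases "even_fun g")
  case True
  then show ?thesis using that[of 1] by (simp add: even_fun_def)
next
  case False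
  then show ?thesis using that[of "-1"] assms by (simp add: class_G_def odd_fun_def)
qed

lemma class_G_mono:
  assumes "g \<in> class_G" "0 \<le> u" "u \<le> v"
  shows "g u \<le> g v"
  using assms by (auto simp: class_G_def mono_on_def)

lemma class_G_nonneg:
  assumes "g \<in> class_G" "0 \<le> u"
  shows "0 \<le> g u"
  using class_G_mono[OF assms(1), of 0 u] assms by (auto simp: class_G_def)

lemma mult3_mono:
  fixes a b c :: real
  assumes "a \<le> a'" "b \<le> b'" "c \<le> c'" "0 \<le> a" "0 \<le> b" "0 \<le> c"
  shows "a * b * c \<le> a' * b' * c'"
  using assms by (intro mult_mono) (auto intro: order_trans)

text \<open>The right side minus the left is \<open>g12 * A - g34 * B\<close> for the
  \<open>A\<close>, \<open>B\<close> below; since \<open>g34 \<le> g12\<close> and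
  \<open>0 \<le> A\<close>, it suffices that \<open>B \<le> A\<close>.\<close>

lemma alternating_products_nonneg:
  fixes g12 :: real
  assumes "0 \<le> g34" "0 \<le> g23" "0 \<le> g24" "0 \<le> g45"
    and "g34 \<le> g12" "g24 \<le> g13" "g23 \<le> g13" "g23 \<le> g14" "g24 \<le> g14"
    and "g25 \<le> g15" "g45 \<le> g35" "g35 \<le> g25"
  shows "g12 * g23 * g24 * g25 + g14 * g24 * g34 * g45
       \<le> g12 * g13 * g14 * g15 + g13 * g23 * g34 * g35"
proof -
  define A where "A = g13 * g14 * g15 - g23 * g24 * g25"
  define B where "B = g14 * g24 * g45 - g13 * g23 * g35"
  have "0 \<le> A"
    unfolding A_def using mult3_mono[of g23 g13 g24 g14 g25 g15] assms by simp
  \<comment> \<open>\<open>A - B\<close> is \<open>g14 * (g13 * g15 - g24 * g45) - g23 * (g24 * g25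
    - g13 * g35)\<close>. The first bracket is nonnegative and dominates the second, and
    \<open>g23 \<le> g14\<close>.\<close>
  have "B \<le> A"
  proof -
    have outer: "g24 * g45 \<le> g13 * g15"
      using assms by (intro mult_mono) auto
    have "g24 * (g25 + g45) \<le> g13 * (g15 + g35)"
      using assms by (intro mult_mono) auto
    then have "g24 * g25 - g13 * g35 \<le> g13 * g15 - g24 * g45"
      by (simp add: algebra_simps)
    then have "g23 * (g24 * g25 - g13 * g35) \<le> g23 * (g13 * g15 - g24 * g45)"
      using assms by (intro mult_left_mono) auto
    also have "\<dots> \<le> g14 * (g13 * g15 - g24 * g45)"
      using assms outer by (intro mult_right_mono) auto
    finally show ?thesis by (simp add: A_def B_def algebra_simps)
  qed
  then have "g34 * B \<le> g34 * A"
    using assms by (intro mult_left_mono) auto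
  also have "\<dots> \<le> g12 * A"
    using assms \<open>0 \<le> A\<close> by (intro mult_right_mono) auto
  finally show ?thesis by (simp add: A_def B_def algebra_simps)
qed

theorem corollary1:
  fixes x a :: "nat \<Rightarrow> real" and g :: "real \<Rightarrow> real"
  assumes "x 1 \<ge> x 2" and "x 2 \<ge> x 3" and "x 3 \<ge> x 4" and "x 4 \<ge> x 5"
    and "x 1 + x 4 \<ge> x 2 + x 3"
    and "a 1 \<ge> max \<bar>a 2\<bar> (\<bar>a 4\<bar> - a 5)"
    and "a 3 \<ge> 0" and "a 5 \<ge> 0" and "a 3 + a 5 \<ge> \<bar>a 4\<bar>"
    and "g \<in> class_G"
  shows "(\<Sum>i\<in>{1..5}. a i * (\<Prod>j\<in>{1..5} - {i}. g (x i - x j))) \<ge> 0"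
proof -
  define d where "d i j = g (x i - x j)" for i j
  obtain s :: real where s: "s = 1 \<or> s = -1" and "\<And>t. g (- t) = s * g t"
    using class_G_parity[OF \<open>g \<in> class_G\<close>] by blast
  then have swap: "d j i = s * d i j" for i j
    unfolding d_def by (metis minus_diff_eq)
  note mono = class_G_mono[OF \<open>g \<in> class_G\<close>] and nonneg = class_G_nonneg[OF \<open>g \<in> class_G\<close>]
  define P1 where "P1 = d 1 2 * d 1 3 * d 1 4 * d 1 5"
  define P2 where "P2 = d 1 2 * d 2 3 * d 2 4 * d 2 5"
  define P3 where "P3 = d 1 3 * d 2 3 * d 3 4 * d 3 5"
  define P4 where "P4 = d 1 4 * d 2 4 * d 3 4 * d 4 5"
  define P5 where "P5 = d 1 5 * d 2 5 * d 3 5 * d 4 5"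
  have P_nonneg: "0 \<le> P1" "0 \<le> P2" "0 \<le> P3" "0 \<le> P4" "0 \<le> P5"
    unfolding P1_def P2_def P3_def P4_def P5_def d_def
    using assms by (auto intro!: mult_nonneg_nonneg nonneg)
  have "d 1 2 * (d 2 3 * d 2 4 * d 2 5) \<le> d 1 2 * (d 1 3 * d 1 4 * d 1 5)"
    unfolding d_def using assms by (intro mult_left_mono mult3_mono mono nonneg) auto
  then have P21: "P2 \<le> P1" by (simp add: P1_def P2_def mult.assoc)
  have "d 1 4 * d 2 4 * d 3 4 * d 4 5 \<le> d 1 5 * d 2 5 * d 3 5 * d 4 5"
    unfolding d_def using assms by (intro mult_right_mono mult3_mono mono nonneg) auto
  then have P45: "P4 \<le> P5" by (simp add: P4_def P5_def)
  \<comment> \<open>The spacing hypothesis enters as \<open>x 3 - x 4 \<le> x 1 - x 2\<close> and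
    \<open>x 2 - x 4 \<le> x 1 - x 3\<close>.\<close>
  have P2413: "P2 + P4 \<le> P1 + P3"
    unfolding P1_def P2_def P3_def P4_def d_def
    using assms by (intro alternating_products_nonneg mono nonneg) auto
  have idx: "{1..5} = {1, 2, 3, 4, 5::nat}" by auto
  have "(\<Sum>i\<in>{1..5}. a i * (\<Prod>j\<in>{1..5} - {i}. d i j))
      = a 1 * (d 1 2 * d 1 3 * d 1 4 * d 1 5) + a 2 * (d 2 1 * d 2 3 * d 2 4 * d 2 5)
      + a 3 * (d 3 1 * d 3 2 * d 3 4 * d 3 5) + a 4 * (d 4 1 * d 4 2 * d 4 3 * d 4 5)
      + a 5 * (d 5 1 * d 5 2 * d 5 3 * d 5 4)"
    unfolding idx by (simp add: insert_Diff_if mult.assoc add.assoc)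
  \<comment> \<open>The \<open>i\<close>-th product has \<open>i - 1\<close> reversed factors, each
    costing \<open>s\<close>; as \<open>s * s = 1\<close>, only even \<open>i\<close> keep an
    \<open>s\<close>.\<close>
  also have "\<dots> = a 1 * P1 + s * a 2 * P2 + a 3 * P3 + s * a 4 * P4 + a 5 * P5"
    using s unfolding P1_def P2_def P3_def P4_def P5_def
      swap[of 2 1] swap[of 3 1] swap[of 4 1] swap[of 5 1] swap[of 3 2]
      swap[of 4 2] swap[of 5 2] swap[of 4 3] swap[of 5 3] swap[of 5 4]
    by auto
  finally have expand: "(\<Sum>i\<in>{1..5}. a i * (\<Prod>j\<in>{1..5} - {i}. g (x i - x j)))
      = a 1 * P1 + s * a 2 * P2 + a 3 * P3 + s * a 4 * P4 + a 5 * P5"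
    by (simp add: d_def)
  \<comment> \<open>\<open>c\<close> is the share of \<open>\<bar>a 4\<bar>\<close> that
    \<open>a 5\<close> cannot absorb; \<open>a 1\<close> and \<open>a 3\<close> are both large
    enough to cover it.\<close>
  define c where "c = max 0 (\<bar>a 4\<bar> - a 5)"
  have c: "0 \<le> c" "c \<le> a 1" "c \<le> a 3" "\<bar>a 4\<bar> - c \<le> a 5" "c \<le> \<bar>a 4\<bar>" "\<bar>a 2\<bar> \<le> a 1"
    using assms by (auto simp: c_def)
  have "- (a 1 * P2) \<le> s * a 2 * P2"
    using s c P_nonneg mult_right_mono[of "- a 1" "s * a 2" P2] by force
  moreover have "- (\<bar>a 4\<bar> * P4) \<le> s * a 4 * P4"
    using s P_nonneg mult_right_mono[of "- \<bar>a 4\<bar>" "s * a 4" P4] by force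
  moreover have "c * (P1 - P2) \<le> a 1 * (P1 - P2)"
    using c P21 by (intro mult_right_mono) auto
  moreover have "c * P3 \<le> a 3 * P3" "(\<bar>a 4\<bar> - c) * P5 \<le> a 5 * P5"
    using c P_nonneg by (auto intro: mult_right_mono)
  moreover have "0 \<le> c * (P1 - P2 + P3 - P4)" "0 \<le> (\<bar>a 4\<bar> - c) * (P5 - P4)"
    using c P2413 P45 by auto
  ultimately show ?thesis
    unfolding expand by (simp add: algebra_simps)
qed

end
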